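(* Let $H=(V,E)$ be a finite hypergraph with edge set $E=\{e_1,\dots,e_m\}$ ($m\ge 1$), where every edge has at least two vertices and $V=e_1\cup\cdots\cup e_m$. Let $e_m^- := e_m\setminus(e_1\cup\cdots\cup e_{m-1})$ and assume $|e_m^-|\ge 2$. Assume moreover: 1. if $|V|\equiv 0 \pmod 4$, then $m\equiv 1\pmod 4$; 2. if $|V|\equiv 2\pmod 4$, then $m\not\equiv 0\pmod 4$; 3. if $|V|\equiv 3\pmod 4$ and $|e_m^-|=2$, then $m\not\equiv 0\pmod 4$. Let $H^-$ be the hypergraph with vertex set $V\setminus e_m^-$ and edge set $\{e_1,\dots,e_{m-1}\}$. If $H^-$ is $\mathbb{Z}_2\times\mathbb{Z}_2$-cordial, then $H$ is $\mathbb{Z}_2\times\mathbb{Z}_2$-cordial.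
   Context: Let $A=\mathbb{Z}_2\times\mathbb{Z}_2$ (the Klein four-group). For a hypergraph $H=(V,E)$ (edges are non-empty subsets of $V$) and a labeling $c:V\to A$, write $v_c(a)=|c^{-1}(a)|$. The labeling $c$ is $A$-friendly if $|v_c(a)-v_c(b)|\le 1$ for all $a,b\in A$. It induces the edge labeling $c^*:E\to A$, $c^*(e)=\sum_{v\in e}c(v)$; write $e_{c^*}(a)=|(c^* )^{-1}(a)|$. The hypergraph $H$ is $A$-cordial if it admits an $A$-friendly labeling $c$ such that $|e_{c^*}(a)-e_{c^*}(b)|\le 1$ for all $a,b\in A$. *)

theory Defs
  imports Main "HOL-Library.Z2" "HOL-Library.Product_Plus"
begin

type_synonym klein = "bit \<times> bit"

definition vcount :: "'a set \<Rightarrow> ('a \<Rightarrow> klein) \<Rightarrow> klein \<Rightarrow> nat" where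
  "vcount V c a = card {v \<in> V. c v = a}"

definition induced_label :: "('a \<Rightarrow> klein) \<Rightarrow> 'a set \<Rightarrow> klein" where
  "induced_label c e = (\<Sum>v\<in>e. c v)"

definition ecount :: "'a set set \<Rightarrow> ('a \<Rightarrow> klein) \<Rightarrow> klein \<Rightarrow> nat" where
  "ecount E c a = card {e \<in> E. induced_label c e = a}"

definition A_friendly :: "'a set \<Rightarrow> ('a \<Rightarrow> klein) \<Rightarrow> bool" where
  "A_friendly V c \<longleftrightarrow>
     (\<forall>a b. \<bar>int (vcount V c a) - int (vcount V c b)\<bar> \<le> 1)"

definition A_cordial :: "'a set \<Rightarrow> 'a set set \<Rightarrow> bool" where
  "A_cordial V E \<longleftrightarrow>
     (\<exists>c. A_friendly V c \<and>
          (\<forall>a b. \<bar>int (ecount E c a) - int (ecount E c b)\<bar> \<le> 1))"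

end

theory Submission
  imports Defs
begin

text \<open>
  Keep the labeling of \<open>H\<^sup>-\<close> and label the new vertices so that every label occurs \<open>q\<close> times on \<open>V\<close>,
  up to one extra occurrence for the labels in a set \<open>T\<close> of \<open>card V mod 4\<close> labels. The elements
  of the Klein group sum to zero, so the labels of all vertices sum to \<open>\<Sum>T\<close>, and the last edge
  receives \<open>\<Sum>T\<close> plus a constant. This label only has to avoid the \<open>(m - 1) mod 4\<close> labels already
  occurring once more often on edges. Choosing \<open>T\<close> to be \<open>{x}\<close>, \<open>{0, x}\<close> or the complement of \<open>{x}\<close>
  gives \<open>\<Sum>T = x\<close>, and the numerical hypotheses leave an admissible \<open>x\<close>.
\<close>

section \<open>Arithmetic of the Klein four-group\<close>

lemma UNIV_klein: "(UNIV :: klein set) = {(0, 0), (0, 1), (1, 0), (1, 1)}"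
proof -
  have "x = 0 \<or> x = 1" for x :: bit
    by (cases x) auto
  then show ?thesis
    by (auto simp: set_eq_iff)
qed

lemma finite_klein [simp]: "finite (A :: klein set)"
  by (rule finite_subset[of _ UNIV]) (auto simp: UNIV_klein)

lemma card_UNIV_klein: "card (UNIV :: klein set) = 4"
  by (simp add: UNIV_klein)

lemma sum_UNIV_klein: "\<Sum> (UNIV :: klein set) = 0"
  by (simp add: UNIV_klein zero_prod_def)

lemma klein_add_self [simp]: "(x :: klein) + x = 0"
  by (cases x) (simp add: zero_prod_def)

text \<open>All four elements sum to zero and every element is its own negative, so complementary
  sets have equal sums.\<close>

lemma sum_Compl_klein: "\<Sum> (- T) = \<Sum> (T :: klein set)"
proof -
  have "\<Sum> T + \<Sum> (- T) = \<Sum> (T \<union> - T)"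
    by (rule sum.union_disjoint[symmetric]) auto
  then have "\<Sum> T + \<Sum> (- T) = \<Sum> T + \<Sum> T"
    by (simp add: sum_UNIV_klein)
  then show ?thesis
    by (rule add_left_imp_eq)
qed

lemma sum_constant_klein:
  "finite A \<Longrightarrow> (\<Sum>v\<in>A. a :: klein) = (if odd (card A) then a else 0)"
  by (induction rule: finite_induct) auto

lemma sum_card_fibres_klein:
  fixes c :: "'a \<Rightarrow> klein"
  assumes "finite A"
  shows "(\<Sum>a\<in>UNIV. card {v \<in> A. c v = a}) = card A"
  using sum.group[OF assms finite_klein, of c UNIV "\<lambda>_. 1 :: nat"] assms by simp

text \<open>A fibre over \<open>a\<close> contributes \<open>a\<close> if its size is odd and
  nothing otherwise. The labels with odd fibres form \<open>T\<close> or \<open>- T\<close>,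
  depending on the parity of \<open>q\<close>, and these have the same sum.\<close>

lemma sum_labels_klein:
  fixes c :: "'a \<Rightarrow> klein"
  assumes "finite V" and "\<And>a. card {v \<in> V. c v = a} = q + of_bool (a \<in> T)"
  shows "(\<Sum>v\<in>V. c v) = \<Sum> T"
proof -
  have "(\<Sum>v\<in>V. c v) = (\<Sum>a\<in>UNIV. \<Sum>v | v \<in> V \<and> c v = a. c v)"
    using sum.group[OF assms(1) finite_klein, of c UNIV c] by simp
  also have "\<dots> = (\<Sum>a\<in>UNIV. if odd (card {v \<in> V. c v = a}) then a else 0)"
    using assms(1) by (intro sum.cong refl) (simp flip: sum_constant_klein)
  also have "\<dots> = \<Sum> {a. odd (q + of_bool (a \<in> T))}"
    by (simp add: assms(2) sum.If_cases)
  also have "\<dots> = \<Sum> T"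
  proof (cases "even q")
    case True
    then have "{a. odd (q + of_bool (a \<in> T))} = T" by auto
    then show ?thesis by simp
  next
    case False
    then have "{a. odd (q + of_bool (a \<in> T))} = - T" by auto
    then show ?thesis by (simp add: sum_Compl_klein)
  qed
  finally show ?thesis .
qed

section \<open>Balanced counts and their excess sets\<close>

definition balanced :: "(klein \<Rightarrow> nat) \<Rightarrow> bool" where
  "balanced f \<longleftrightarrow> (\<forall>a b. \<bar>int (f a) - int (f b)\<bar> \<le> 1)"

lemma A_cordial_balanced:
  "A_cordial V E \<longleftrightarrow> (\<exists>c. balanced (vcount V c) \<and> balanced (ecount E c))"
  by (simp add: A_cordial_def A_friendly_def balanced_def)

lemma balanced_of_bool: "balanced (\<lambda>a. q + of_bool (a \<in> T))"
  by (auto simp: balanced_def)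

text \<open>Every value is the minimum \<open>p\<close> or \<open>p + 1\<close>. As the minimum is
  attained, fewer than four labels exceed it, so \<open>p\<close> and \<open>card U\<close> are the
  quotient and the remainder of the total by 4.\<close>

lemma balancedE:
  assumes "balanced f"
  obtains U where "card U = sum f UNIV mod 4" and "U \<noteq> UNIV"
    and "\<And>a. f a = sum f UNIV div 4 + of_bool (a \<in> U)"
proof -
  define p where "p = Min (range f)"
  define U where "U = {a. f a \<noteq> p}"
  have fin: "finite (range f)" by simp
  have "p \<in> range f"
    unfolding p_def by (rule Min_in[OF fin]) simp
  then obtain b where b: "f b = p" by auto
  have f: "f a = p + of_bool (a \<in> U)" for a
  proof -
    have "p \<le> f a" unfolding p_def by (rule Min_le[OF fin]) simp
    moreover have "\<bar>int (f a) - int (f b)\<bar> \<le> 1"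
      using assms unfolding balanced_def by blast
    ultimately show ?thesis using b by (auto simp: U_def)
  qed
  have "b \<notin> U" using b by (simp add: U_def)
  then have ne: "U \<noteq> UNIV" by auto
  then have "card U < 4"
    using psubset_card_mono[of UNIV U] by (auto simp: card_UNIV_klein)
  moreover have "sum f UNIV = 4 * p + card U"
    unfolding f sum.distrib by (simp add: card_UNIV_klein)
  ultimately show thesis
    using that[of U] ne f by simp
qed

section \<open>Prescribed fibre sizes and the choice of the excess set\<close>

lemma ex_labeling_fibre_sizes:
  fixes s :: "klein \<Rightarrow> nat"
  assumes "finite S" and "sum s UNIV = card S"
  shows "\<exists>g. \<forall>a. card {v \<in> S. g v = a} = s a"
  using assms
proof (induction arbitrary: s rule: finite_induct)
  case empty
  then show ?case by simp
next
  case (insert x S)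
  then have "sum s UNIV \<noteq> 0" by simp
  \<comment> \<open>The new element takes a label still in demand; the remaining demand is met on
    \<open>S\<close> by induction.\<close>
  then obtain b where b: "s b > 0" by (metis gr0I sum.neutral)
  have "sum (s(b := s b - 1)) UNIV = card S"
    using insert b by (simp add: sum.remove[of UNIV b])
  then obtain g where g: "\<And>a. card {v \<in> S. g v = a} = (s(b := s b - 1)) a"
    using insert.IH by blast
  have "card {v \<in> insert x S. (g(x := b)) v = a} = s a" for a
  proof -
    have "{v \<in> insert x S. (g(x := b)) v = a} =
        (if a = b then insert x {v \<in> S. g v = a} else {v \<in> S. g v = a})"
      using insert by auto
    then show ?thesis using insert b g[of a] by auto
  qed
  then show ?case by blast
qed

lemma ex_extension_fibre_sizes:
  fixes c :: "'a \<Rightarrow> klein"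
  assumes "finite V" and "W \<subseteq> V" and "sum f UNIV = card V"
    and "\<And>a. vcount W c a \<le> f a"
  obtains d where "\<And>v. v \<in> W \<Longrightarrow> d v = c v" and "\<And>a. vcount V d a = f a"
proof -
  have finW: "finite W" using assms finite_subset by blast
  have "(\<Sum>a\<in>UNIV. f a - vcount W c a) = card V - card W"
    using assms sum_card_fibres_klein[OF finW, of c]
    by (simp add: sum_subtractf_nat vcount_def)
  also have "\<dots> = card (V - W)"
    using finW assms by (simp add: card_Diff_subset)
  finally obtain g where g: "\<And>a. card {v \<in> V - W. g v = a} = f a - vcount W c a"
    using ex_labeling_fibre_sizes[of "V - W" "\<lambda>a. f a - vcount W c a"] assms(1) by auto
  define d where "d v = (if v \<in> W then c v else g v)" for v
  have "vcount V d a = f a" for a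
  proof -
    have "{v \<in> V. d v = a} = {v \<in> W. c v = a} \<union> {v \<in> V - W. g v = a}"
      using assms(2) by (auto simp: d_def)
    then have "vcount V d a = vcount W c a + card {v \<in> V - W. g v = a}"
      using assms(1) finW by (auto simp: vcount_def intro!: card_Un_disjoint)
    then show ?thesis using assms(4)[of a] unfolding g by simp
  qed
  then show thesis by (intro that[of d]) (simp_all add: d_def)
qed

text \<open>\<open>X\<close> will hold the sums that give the last edge an admissible label.
  \<open>P\<close> will say that the quotient by 4 does not grow; then the labels in
  \<open>U\<close> already occur once more often than that quotient and must stay in excess.\<close>

lemma ex_excess_set:
  fixes X U :: "klein set"
  assumes "t < 4" and "X \<noteq> {}"
    and "t = 0 \<longrightarrow> X = UNIV"
    and "t = 2 \<longrightarrow> 2 \<le> card X"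
    and "P \<longrightarrow> t = 2 \<and> U = {} \<or> t = 3 \<and> card U < card X"
  obtains T where "card T = t" and "\<Sum> T \<in> X" and "P \<longrightarrow> U \<subseteq> T"
proof -
  consider "t = 0" | "t = 1" | "t = 2" | "t = 3" using assms(1) by linarith
  then show thesis
  proof cases
    case 1
    then show thesis using assms by (intro that[of "{}"]) auto
  next
    case 2
    obtain x where "x \<in> X" using assms(2) by blast
    then show thesis using 2 assms by (intro that[of "{x}"]) auto
  next
    case 3
    \<comment> \<open>The set \<open>{0, x}\<close> has two elements only if \<open>x\<close> is
      nonzero, hence the demand for two elements in \<open>X\<close>.\<close>
    then have "\<not> X \<subseteq> {0}"
      using assms(4) card_mono[of "{0}" X] by fastforce
    then obtain x where "x \<in> X" "x \<noteq> 0" by blast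
    then show thesis using 3 assms by (intro that[of "{0, x}"]) auto
  next
    case 4
    have "\<exists>x \<in> X. P \<longrightarrow> x \<notin> U"
      using 4 assms(2,5) card_mono[of U X] by fastforce
    then obtain x where "x \<in> X" "P \<longrightarrow> x \<notin> U" by blast
    moreover have "card (- {x}) = 3"
      by (simp add: card_Diff_subset card_UNIV_klein Compl_eq_Diff_UNIV)
    ultimately show thesis using 4 by (intro that[of "- {x}"]) (simp_all add: sum_Compl_klein)
  qed
qed

section \<open>Adding one edge\<close>

lemma ecount_insert:
  assumes "finite E" and "e \<notin> E"
  shows "ecount (insert e E) c a = ecount E c a + of_bool (a = induced_label c e)"
proof -
  have "{e' \<in> insert e E. induced_label c e' = a} =
      (if a = induced_label c e then insert e {e' \<in> E. induced_label c e' = a}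
       else {e' \<in> E. induced_label c e' = a})"
    by auto
  then show ?thesis using assms by (auto simp: ecount_def)
qed

text \<open>Since \<open>m\<close> is \<open>card E + 1\<close>, the residues 1 and 0 of
  \<open>m\<close> modulo 4 turn into 0 and 3 for \<open>card E\<close>.\<close>

lemma A_cordial_insert_edge:
  fixes V :: "'a set"
  assumes finE: "finite E" and e: "e \<notin> E" "finite e" "\<Union> E \<subseteq> W" "finite W"
    and V: "V = W \<union> e" and k: "2 \<le> card (e - W)"
    and h0: "card V mod 4 = 0 \<longrightarrow> card E mod 4 = 0"
    and h2: "card V mod 4 = 2 \<longrightarrow> card E mod 4 \<noteq> 3"
    and h3: "card V mod 4 = 3 \<and> card (e - W) = 2 \<longrightarrow> card E mod 4 \<noteq> 3"
    and cordial: "A_cordial W E"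
  shows "A_cordial V (insert e E)"
proof -
  obtain c where "balanced (vcount W c)" and "balanced (ecount E c)"
    using cordial by (auto simp: A_cordial_balanced)
  have sumW: "sum (vcount W c) UNIV = card W"
    using sum_card_fibres_klein[OF e(4)] by (simp add: vcount_def)
  have sumE: "sum (ecount E c) UNIV = card E"
    using sum_card_fibres_klein[OF finE] by (simp add: ecount_def)
  obtain U where U: "card U = card W mod 4"
      "\<And>a. vcount W c a = card W div 4 + of_bool (a \<in> U)"
    using balancedE[OF \<open>balanced (vcount W c)\<close>] unfolding sumW by blast
  obtain Y where Y: "card Y = card E mod 4" "Y \<noteq> UNIV"
      "\<And>a. ecount E c a = card E div 4 + of_bool (a \<in> Y)"
    using balancedE[OF \<open>balanced (ecount E c)\<close>] unfolding sumE by blast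
  have finV: "finite V" using V e by simp
  have cardV: "card V = card W + card (e - W)"
    unfolding V using e by (subst card_Un_disjoint[symmetric]) (auto intro: arg_cong[where f = card])
  \<comment> \<open>The new vertices contribute equally to the sums over \<open>e\<close> and over
    \<open>V\<close>; so, in characteristic 2, these sums differ by \<open>r\<close>, which depends
    only on the old labels.\<close>
  define r where "r = (\<Sum>v\<in>e \<inter> W. c v) + (\<Sum>v\<in>W. c v)"
  define X where "X = (\<lambda>y. y + r) ` (- Y)"
  have cardX: "card X = 4 - card E mod 4"
    using Y(1) by (simp add: X_def card_image inj_on_def Compl_eq_Diff_UNIV card_Diff_subset card_UNIV_klein)
  obtain T where T: "card T = card V mod 4" "\<Sum> T \<in> X"
      "card V div 4 = card W div 4 \<longrightarrow> U \<subseteq> T"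
  proof (rule ex_excess_set[of "card V mod 4" X "card V div 4 = card W div 4" U])
    show "X \<noteq> {}" using Y(2) by (auto simp: X_def)
    show "card V mod 4 = 0 \<longrightarrow> X = UNIV"
      using h0 cardX card_subset_eq[of UNIV X] by (simp add: card_UNIV_klein)
    show "card V mod 4 = 2 \<longrightarrow> 2 \<le> card X"
      unfolding cardX using h2 by presburger
    show "card V div 4 = card W div 4 \<longrightarrow>
        card V mod 4 = 2 \<and> U = {} \<or> card V mod 4 = 3 \<and> card U < card X"
    proof
      assume "card V div 4 = card W div 4"
      \<comment> \<open>With equal quotients the remainder grows by the number of new vertices,
        which is at least 2. This leaves three cases.\<close>
      then have "card V mod 4 = card W mod 4 + card (e - W)"
        using cardV by (metis add.assoc add_left_cancel div_mult_mod_eq)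
      then consider "card V mod 4 = 2" "card W mod 4 = 0"
        | "card V mod 4 = 3" "card W mod 4 = 0"
        | "card V mod 4 = 3" "card W mod 4 = 1" "card (e - W) = 2"
        using k mod_less_divisor[of 4 "card V"] by linarith
      then show "card V mod 4 = 2 \<and> U = {} \<or> card V mod 4 = 3 \<and> card U < card X"
      proof cases
        case 1
        then show ?thesis using U(1) by simp
      next
        case 2
        then show ?thesis using U(1) cardX by simp
      next
        case 3
        \<comment> \<open>Here \<open>U\<close> is a singleton, and \<open>h3\<close> ensures that
          \<open>X\<close> has at least two elements.\<close>
        have "card E mod 4 < 4" by simp
        then show ?thesis using 3 U(1) cardX h3 by simp
      qed
    qed
  qed simp_all
  define f where "f a = card V div 4 + of_bool (a \<in> T)" for a
  have "sum f UNIV = card V"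
    unfolding f_def sum.distrib using T(1) by (simp add: card_UNIV_klein)
  moreover have "vcount W c a \<le> f a" for a
  proof (cases "card V div 4 = card W div 4")
    case True
    then show ?thesis using T(3) by (auto simp: U(2) f_def)
  next
    case False
    \<comment> \<open>A larger quotient already absorbs any old excess, so \<open>T\<close> need not
      contain \<open>U\<close>.\<close>
    moreover have "card W div 4 \<le> card V div 4"
      using cardV by (intro div_le_mono) simp
    ultimately show ?thesis by (auto simp: U(2) f_def)
  qed
  ultimately obtain d where dW: "\<And>v. v \<in> W \<Longrightarrow> d v = c v" and dV: "\<And>a. vcount V d a = f a"
    using ex_extension_fibre_sizes[OF finV, of W f c] V by auto
  have sumV: "(\<Sum>v\<in>V. d v) = \<Sum> T"
    using dV by (intro sum_labels_klein[OF finV]) (simp add: vcount_def f_def)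
  have "(\<Sum>v\<in>V. d v) = (\<Sum>v\<in>W. c v) + (\<Sum>v\<in>e - W. d v)"
  proof -
    have "V = W \<union> (e - W)" using V by auto
    then have "(\<Sum>v\<in>V. d v) = (\<Sum>v\<in>W. d v) + (\<Sum>v\<in>e - W. d v)"
      using e by (metis Diff_disjoint finite_Diff sum.union_disjoint)
    then show ?thesis using dW by simp
  qed
  moreover have "induced_label d e = (\<Sum>v\<in>e \<inter> W. c v) + (\<Sum>v\<in>e - W. d v)"
    unfolding induced_label_def using dW by (subst sum.Int_Diff[OF e(2), of _ W]) simp
  ultimately have "induced_label d e + r = \<Sum> T + ((\<Sum>v\<in>e \<inter> W. c v) + (\<Sum>v\<in>e \<inter> W. c v))"
    unfolding sumV[symmetric] r_def by (simp only: ac_simps)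
  then have "induced_label d e + r \<in> X" using T(2) by simp
  \<comment> \<open>Translation by \<open>r\<close> is injective, so the label comes from
    \<open>- Y\<close>.\<close>
  then have dY: "induced_label d e \<notin> Y" by (auto simp: X_def)
  have "induced_label d e' = induced_label c e'" if "e' \<in> E" for e'
    unfolding induced_label_def using that e(3) dW by (intro sum.cong) auto
  then have "ecount E d = ecount E c"
    unfolding ecount_def by (intro ext arg_cong[where f = card]) auto
  \<comment> \<open>Because the new label lies outside \<open>Y\<close>, no label gets a second
    extra occurrence.\<close>
  then have "ecount (insert e E) d a = card E div 4 + of_bool (a \<in> insert (induced_label d e) Y)" for a
    using dY by (cases "a = induced_label d e") (simp_all add: ecount_insert[OF finE e(1)] Y(3))
  then have "ecount (insert e E) d = (\<lambda>a. card E div 4 + of_bool (a \<in> insert (induced_label d e) Y))"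
    by (rule ext)
  moreover have "vcount V d = (\<lambda>a. card V div 4 + of_bool (a \<in> T))"
    using dV by (auto simp: f_def)
  ultimately show ?thesis
    unfolding A_cordial_balanced by (intro exI[of _ d]) (simp only: balanced_of_bool)
qed

theorem theorem2:
  fixes es :: "'a set list" and V :: "'a set"
  defines "m \<equiv> length es"
  defines "E \<equiv> set es"
  defines "em_minus \<equiv> es ! (m - 1) - \<Union> (set (butlast es))"
  assumes "m \<ge> 1"
    and "distinct es"
    and "\<forall>e\<in>E. finite e \<and> card e \<ge> 2"
    and "V = \<Union> E"
    and "card em_minus \<ge> 2"
    and "card V mod 4 = 0 \<longrightarrow> m mod 4 = 1"
    and "card V mod 4 = 2 \<longrightarrow> m mod 4 \<noteq> 0"
    and "card V mod 4 = 3 \<and> card em_minus = 2 \<longrightarrow> m mod 4 \<noteq> 0"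
    and "A_cordial (V - em_minus) (set (butlast es))"
  shows "A_cordial V E"
proof -
  define e where "e = last es"
  define E' where "E' = set (butlast es)"
  define W where "W = \<Union> E'"
  have "es \<noteq> []" using assms(4) by (auto simp: m_def)
  then have es: "es = butlast es @ [e]" and "em_minus = e - W"
    by (simp add: e_def) (simp add: e_def em_minus_def m_def W_def E'_def last_conv_nth \<open>es \<noteq> []\<close>)
  have E: "E = insert e E'"
    unfolding E_def E'_def by (subst es) simp
  have "distinct (butlast es @ [e])" using assms(5) by (subst (asm) es)
  then have "e \<notin> E'" and card_E': "card E' = m - 1"
    by (auto simp: E'_def m_def distinct_card)
  have V: "V = W \<union> e" using assms(7) by (auto simp: E W_def)
  have "V - em_minus = W" using V \<open>em_minus = e - W\<close> by auto
  have mod_m: "card E' mod 4 = 0 \<longleftrightarrow> m mod 4 = 1" "card E' mod 4 = 3 \<longleftrightarrow> m mod 4 = 0"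
    unfolding card_E' using assms(4) by (cases m; simp add: mod_Suc)+
  show ?thesis
    unfolding E
  proof (rule A_cordial_insert_edge)
    show "finite E'" by (simp add: E'_def)
    show "finite e" "finite W" using assms(6) by (auto simp: E W_def E'_def)
    show "\<Union> E' \<subseteq> W" by (simp add: W_def)
    show "A_cordial W E'"
      using assms(12) \<open>V - em_minus = W\<close> by (simp add: E'_def)
  qed (use assms(8-11) \<open>e \<notin> E'\<close> V mod_m in \<open>simp_all add: \<open>em_minus = e - W\<close>\<close>)
qed

end
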